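(* Let $p>3$ be a prime. Then $V_{p-1}\equiv256^{p-1}\pmod{p^3}$.
   Context: For $n\ge0$, $V_n=\sum_{k=0}^n\binom{2k}{k}^2\binom{2n-2k}{n-k}^2$. *)

theory Defs
  imports "HOL-Number_Theory.Number_Theory"
begin

definition V :: "nat \<Rightarrow> nat" where
  "V n = (\<Sum>k=0..n. ((2 * k) choose k)\<^sup>2 * ((2 * n - 2 * k) choose (n - k))\<^sup>2)"

end

theory Submission
  imports Defs
begin

text \<open>
  Write p = 2m + 1 and let T(k) be the product of the central binomial coefficients with indices k
  and 2m - k, so that the sum in question is that of the squares of the T(k). The middle term is
  the fourth power of the central binomial coefficient with index m, which Morley's congruence
  evaluates. For k < m the recurrence in k gives (2k + 1) T(k) = -p modulo the square of p, so these
  terms, and symmetrically those with k > m, contribute the square of p times a sum of inverse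
  squares of odd residues. That sum vanishes modulo p, because doubling permutes the nonzero
  residues and p does not divide 3.
\<close>

section \<open>Sums of inverse squares modulo a prime\<close>

lemma coprime_prime_of_less:
  fixes p x :: int
  assumes "prime p" "x \<in> {1..<p}"
  shows "coprime x p"
  using assms by (metis atLeastLessThan_iff coprime_commute less_le_trans not_less
      prime_imp_coprime zdvd_imp_le zero_less_one)

text \<open>Doubling permutes the nonzero residues and divides each inverse square by 4, so the sum
  S satisfies S = 4 S modulo p, and 3 is invertible. Since \<open>c\<close> is any choice of
  inverses modulo p, inverses modulo a higher power of p can be inserted later.\<close>

lemma sum_inverse_squares_cong_0:
  fixes p :: int and c :: "int \<Rightarrow> int"
  assumes "prime p" "p > 3" and c: "\<And>x. x \<in> {1..<p} \<Longrightarrow> [x * c x = 1] (mod p)"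
  shows "[(\<Sum>x\<in>{1..<p}. (c x)\<^sup>2) = 0] (mod p)"
proof -
  define S where "S = (\<Sum>x\<in>{1..<p}. (c x)\<^sup>2)"
  note cop = coprime_prime_of_less[OF assms(1)]
  have bij: "bij_betw (\<lambda>x. 2 * x mod p) {1..<p} {1..<p}"
    by (rule bij_betw_int_remainders_mult) (use cop[of 2] assms in auto)
  have "[(c x)\<^sup>2 = 4 * (c (2 * x mod p))\<^sup>2] (mod p)" if x: "x \<in> {1..<p}" for x
  proof -
    let ?y = "2 * x mod p"
    have "?y \<in> {1..<p}"
      using bij x by (auto simp: bij_betw_def)
    then have "[?y * c ?y = 1] (mod p)"
      by (rule c)
    then have "[2 * x * c ?y = 1] (mod p)"
      by (simp add: cong_def mod_mult_left_eq)
    \<comment> \<open>The same product is evaluated twice, once by cancelling \<open>2 * x\<close>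
      against \<open>c ?y\<close> and once by cancelling \<open>x\<close> against
      \<open>c x\<close>.\<close>
    then have "[c x * (2 * x * c ?y) = c x * 1] (mod p)"
      by (intro cong_mult cong_refl)
    moreover have "[(x * c x) * (2 * c ?y) = 1 * (2 * c ?y)] (mod p)"
      by (intro cong_mult cong_refl c x)
    ultimately have "[c x = 2 * c ?y] (mod p)"
      by (simp add: ac_simps) (meson cong_sym cong_trans)
    then have "[(c x)\<^sup>2 = (2 * c ?y)\<^sup>2] (mod p)"
      by (rule cong_pow)
    then show ?thesis
      by (simp add: power_mult_distrib)
  qed
  then have "[S = (\<Sum>x\<in>{1..<p}. 4 * (c (2 * x mod p))\<^sup>2)] (mod p)"
    unfolding S_def by (rule cong_sum)
  also have "(\<Sum>x\<in>{1..<p}. 4 * (c (2 * x mod p))\<^sup>2) = 4 * S"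
    unfolding S_def using sum.reindex_bij_betw[OF bij, of "\<lambda>y. (c y)\<^sup>2"]
    by (simp flip: sum_distrib_left)
  finally have "p dvd 3 * S"
    by (auto simp: cong_iff_dvd_diff dvd_diff_commute)
  then show ?thesis
    unfolding S_def[symmetric] using cop[of 3] assms(2)
    by (simp add: cong_0_iff coprime_commute coprime_dvd_mult_right_iff)
qed

lemma sum_even_odd_split:
  fixes f :: "int \<Rightarrow> 'a :: comm_monoid_add"
  shows "(\<Sum>x\<in>{1..<2 * int m + 1}. f x) = (\<Sum>j=1..m. f (2 * int j)) + (\<Sum>j=1..m. f (2 * int j - 1))"
proof (induction m)
  case (Suc m)
  have "{1..<2 * int (Suc m) + 1} = insert (2 * int m + 2) (insert (2 * int m + 1) {1..<2 * int m + 1})"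
    by auto
  then show ?case
    using Suc by (simp add: ac_simps)
qed simp

text \<open>As p is odd, x -> p - x exchanges even and odd residues while preserving inverse
  squares. The two half sums therefore agree modulo p; their total vanishes, and 2 is invertible.
  The even half serves Morley's congruence, the odd half the final sum.\<close>

lemma sum_even_odd_inverse_squares_cong_0:
  fixes p :: int and c :: "int \<Rightarrow> int"
  assumes "prime p" "p > 3" and p: "p = 2 * int m + 1"
    and c: "\<And>x. x \<in> {1..<p} \<Longrightarrow> [x * c x = 1] (mod p)"
  shows "[(\<Sum>j=1..m. (c (2 * int j))\<^sup>2) = 0] (mod p)"
    and "[(\<Sum>j=1..m. (c (2 * int j - 1))\<^sup>2) = 0] (mod p)"
proof -
  let ?E = "\<Sum>j=1..m. (c (2 * int j))\<^sup>2" and ?O = "\<Sum>j=1..m. (c (2 * int j - 1))\<^sup>2"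
  have neg: "[(c (p - x))\<^sup>2 = (c x)\<^sup>2] (mod p)" if x: "x \<in> {1..<p}" for x
  proof -
    have "[c x * ((p - x) * c (p - x)) = c x * 1] (mod p)"
      by (intro cong_mult cong_refl c) (use x in auto)
    moreover have "[c (p - x) * (x * c x) = c (p - x) * 1] (mod p)"
      by (intro cong_mult cong_refl c x)
    \<comment> \<open>Adding the two relations makes (p - x) + x = p appear as a factor, so the
      inverses of x and p - x are opposite modulo p.\<close>
    ultimately have "p dvd c x * ((p - x) * c (p - x)) - c x + (c (p - x) * (x * c x) - c (p - x))"
      by (auto simp: cong_iff_dvd_diff)
    also have "\<dots> = p * (c x * c (p - x)) - (c x + c (p - x))"
      by (simp add: algebra_simps)
    finally have "p dvd c (p - x) + c x"
      by (simp add: dvd_diff_right_iff add.commute)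
    then have "p dvd (c (p - x) + c x) * (c (p - x) - c x)"
      by simp
    then show ?thesis
      by (simp add: cong_iff_dvd_diff power2_eq_square algebra_simps)
  qed
  have "?O = (\<Sum>j=1..m. (c (p - 2 * int j))\<^sup>2)"
    by (subst sum.atLeastAtMost_rev) (auto intro!: sum.cong simp: p of_nat_diff algebra_simps)
  also have "[\<dots> = ?E] (mod p)"
    by (intro cong_sum neg) (auto simp: p)
  finally have OE: "[?O = ?E] (mod p)" .
  have "[?E + ?O = 0] (mod p)"
    using sum_inverse_squares_cong_0[OF assms(1,2) c] sum_even_odd_split[of "\<lambda>x. (c x)\<^sup>2" m]
    by (simp add: p)
  then have "p dvd ?E + ?O"
    by (simp only: cong_0_iff)
  moreover have "p dvd ?O - ?E"
    using OE by (simp only: cong_iff_dvd_diff)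
  ultimately have "p dvd (?E + ?O) - (?O - ?E)"
    by (rule dvd_diff)
  then have "p dvd 2 * ?E"
    by (simp add: algebra_simps)
  then have "p dvd ?E"
    using p by (simp add: coprime_dvd_mult_right_iff)
  then show "[?E = 0] (mod p)"
    by (simp add: cong_0_iff)
  with OE show "[?O = 0] (mod p)"
    by (rule cong_trans)
qed

section \<open>Morley's congruence for the middle binomial coefficient\<close>

text \<open>The coefficient of the second-order term is the second elementary symmetric function,
  written through power sums by Newton's identity. Doubling both sides avoids dividing by 2.\<close>

lemma prod_one_minus_cong_cube:
  fixes x :: int and b :: "'a \<Rightarrow> int"
  assumes "finite S"
  shows "[2 * (\<Prod>j\<in>S. 1 - x * b j) =
          2 - 2 * x * (\<Sum>j\<in>S. b j) + x\<^sup>2 * ((\<Sum>j\<in>S. b j)\<^sup>2 - (\<Sum>j\<in>S. (b j)\<^sup>2))] (mod x ^ 3)"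
  using assms
proof induction
  case (insert i S)
  let ?e = "\<Sum>j\<in>S. b j" and ?q = "\<Sum>j\<in>S. (b j)\<^sup>2"
  have "[(1 - x * b i) * (2 * (\<Prod>j\<in>S. 1 - x * b j)) =
         (1 - x * b i) * (2 - 2 * x * ?e + x\<^sup>2 * (?e\<^sup>2 - ?q))] (mod x ^ 3)"
    by (intro cong_mult cong_refl insert.IH)
  also have "(1 - x * b i) * (2 - 2 * x * ?e + x\<^sup>2 * (?e\<^sup>2 - ?q)) =
      2 - 2 * x * (b i + ?e) + x\<^sup>2 * ((b i + ?e)\<^sup>2 - ((b i)\<^sup>2 + ?q)) - x ^ 3 * (b i * (?e\<^sup>2 - ?q))"
    by (simp add: power2_eq_square power3_eq_cube algebra_simps)
  also have "[\<dots> = 2 - 2 * x * (b i + ?e) + x\<^sup>2 * ((b i + ?e)\<^sup>2 - ((b i)\<^sup>2 + ?q))] (mod x ^ 3)"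
    by (simp add: cong_iff_dvd_diff)
  finally show ?case
    using insert.hyps by (simp add: mult.left_commute)
qed simp

lemma prod_times_binomial:
  "(\<Prod>j=1..k. int j) * int (n + k choose k) = (\<Prod>j=1..k. int n + int j)"
proof (induction k)
  case (Suc k)
  have "int (Suc k) * int (n + Suc k choose Suc k) = int (n + Suc k) * int (n + k choose k)"
    using Suc_times_binomial[of k "n + k"] by (metis add_Suc_right of_nat_mult)
  then have "(\<Prod>j=1..Suc k. int j) * int (n + Suc k choose Suc k) =
      int (n + Suc k) * ((\<Prod>j=1..k. int j) * int (n + k choose k))"
    by (simp add: ac_simps del: binomial_Suc_Suc of_nat_Suc of_nat_add)
  then show ?case
    unfolding Suc by (simp add: ac_simps)
qed simp

text \<open>The numerator (m + 1)...(2m) is read backwards, so that with p = 2m + 1 each factor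
  becomes a perturbation of -2j by 2p.\<close>

lemma prod_evens_times_central_binomial:
  "(\<Prod>j=1..m. 2 * int j) * int (2 * m choose m) = (\<Prod>j=1..m. 2 * (2 * int m + 1) - 2 * int j)"
proof -
  have "(\<Prod>j=1..m. 2 * int j) * int (2 * m choose m) = (\<Prod>j=1..m. 2 * (int m + int j))"
    using prod_times_binomial[of m m]
    by (simp add: mult_2[of m] prod.distrib mult.assoc del: distrib_left_numeral)
  also have "\<dots> = (\<Prod>j=1..m. 2 * (2 * int m + 1) - 2 * int j)"
    by (subst prod.atLeastAtMost_rev) (auto intro!: prod.cong simp: of_nat_diff algebra_simps)
  finally show ?thesis .
qed

lemma Suc_times_central_binomial:
  "Suc k * (2 * Suc k choose Suc k) = 2 * (2 * k + 1) * (2 * k choose k)"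
proof -
  have "Suc k * (Suc k * (2 * Suc k choose Suc k)) = Suc k * (2 * Suc k * (2 * k + 1 choose k))"
  proof -
    have "2 * Suc k = Suc (2 * k + 1)"
      by simp
    then show ?thesis
      using Suc_times_binomial[of k "2 * k + 1"] by metis
  qed
  also have "(2 * k + 1 choose k) = (Suc (2 * k) choose Suc k)"
    using binomial_symmetric[of k "2 * k + 1"] by simp
  also have "Suc k * (2 * Suc k * (Suc (2 * k) choose Suc k))
      = 2 * Suc k * (Suc k * (Suc (2 * k) choose Suc k))"
    by (simp only: ac_simps)
  also have "Suc k * (Suc (2 * k) choose Suc k) = (2 * k + 1) * (2 * k choose k)"
    using Suc_times_binomial[of k "2 * k"] by simp
  also have "2 * Suc k * \<dots> = Suc k * (2 * (2 * k + 1) * (2 * k choose k))"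
    by (simp only: ac_simps)
  finally show ?thesis
    by (simp only: mult_cancel1) simp
qed

text \<open>A second evaluation of the same left side, through the product of the odd numbers below
  2m: here the perturbation of -2j is p instead of 2p, at the cost of a power of 4.\<close>

lemma prod_evens_times_central_binomial':
  "(\<Prod>j=1..m. 2 * int j) * int (2 * m choose m) = 4 ^ m * (\<Prod>j=1..m. (2 * int m + 1) - 2 * int j)"
proof -
  have "(\<Prod>j=1..m. 2 * int j) * int (2 * m choose m) = 4 ^ m * (\<Prod>j=1..m. 2 * int j - 1)"
  proof (induction m)
    case (Suc m)
    have "(\<Prod>j=1..Suc m. 2 * int j) * int (2 * Suc m choose Suc m) =
        2 * (\<Prod>j=1..m. 2 * int j) * int (Suc m * (2 * Suc m choose Suc m))"
      by (simp add: algebra_simps del: binomial_Suc_Suc)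
    also have "\<dots> = 4 * (2 * int m + 1) * ((\<Prod>j=1..m. 2 * int j) * int (2 * m choose m))"
      unfolding Suc_times_central_binomial by (simp add: algebra_simps)
    finally show ?case
      unfolding Suc by (simp add: algebra_simps)
  qed simp
  also have "(\<Prod>j=1..m. 2 * int j - 1) = (\<Prod>j=1..m. (2 * int m + 1) - 2 * int j)"
    by (subst prod.atLeastAtMost_rev) (auto intro!: prod.cong simp: of_nat_diff algebra_simps)
  finally show ?thesis .
qed

text \<open>
  With A and B the products of 1 - 2px and 1 - px over the inverses x of 2, 4, ..., 2m, the
  binomial coefficient is, up to sign, congruent both to A and to B times the m-th power of 4.
  Comparing expansions to second order shows that A is congruent to the square of B, whence B is
  congruent to the m-th power of 4.
\<close>
theorem Morley_congruence:
  fixes p :: int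
  assumes "prime p" "p > 3" and p: "p = 2 * int m + 1"
  shows "[int (2 * m choose m) = (-1) ^ m * 4 ^ (2 * m)] (mod p ^ 3)"
proof -
  define c where "c = modular_inverse (p ^ 3)"
  have inv: "[x * c x = 1] (mod p ^ 3)" if "x \<in> {1..<p}" for x
    unfolding c_def by (rule cong_modular_inverse1) (use coprime_prime_of_less[OF assms(1) that] in simp)
  define b where "b j = c (2 * int j)" for j
  define C where "C = int (2 * m choose m)"
  define D where "D = (\<Prod>j=1..m. 2 * int j)"
  define F where "F x = (\<Prod>j=1..m. 1 - x * b j)" for x
  define e where "e = (\<Sum>j=1..m. b j)"
  define q where "q = (\<Sum>j=1..m. (b j)\<^sup>2)"
  \<comment> \<open>The sign produced by reversing all m factors x - 2j.\<close>
  define s :: int where "s = (-1) ^ m"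
  have cop4: "coprime 4 (p ^ 3)"
  proof -
    have "coprime (2 ^ 2) (p ^ 3)"
      using p by (simp only: coprime_power_left_iff coprime_power_right_iff) simp
    then show ?thesis
      by simp
  qed
  have copD: "coprime D (p ^ 3)"
    unfolding D_def
    by (intro prod_coprime_left coprime_power_right_iff[THEN iffD2] disjI1 coprime_prime_of_less assms)
       (auto simp: p)
  have "coprime (1 - p * b j) (p ^ 3)" for j
  proof -
    have "coprime (1 - p * b j) p"
    proof (rule coprimeI)
      fix d assume "d dvd 1 - p * b j" "d dvd p"
      then have "d dvd (1 - p * b j) + p * b j"
        by (intro dvd_add dvd_mult2)
      then show "is_unit d"
        by simp
    qed
    then show ?thesis
      by simp
  qed
  then have copB: "coprime (F p) (p ^ 3)"
    unfolding F_def by (intro prod_coprime_left)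
  have F: "[(\<Prod>j=1..m. 2 * int j - x) = D * F x] (mod p ^ 3)" for x
  proof -
    have "[2 * int j - x = 2 * int j * (1 - x * b j)] (mod p ^ 3)" if "j \<in> {1..m}" for j
    proof -
      have "[2 * int j * b j = 1] (mod p ^ 3)"
        unfolding b_def using that by (intro inv) (auto simp: p)
      then have "[2 * int j - x * (2 * int j * b j) = 2 * int j - x * 1] (mod p ^ 3)"
        by (intro cong_diff cong_mult cong_refl)
      then show ?thesis
        by (simp add: algebra_simps cong_sym)
    qed
    then have "[(\<Prod>j=1..m. 2 * int j - x) = (\<Prod>j=1..m. 2 * int j * (1 - x * b j))] (mod p ^ 3)"
      by (rule cong_prod)
    then show ?thesis
      unfolding D_def F_def by (simp only: prod.distrib)
  qed
  have s: "s * (s * x) = x" for x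
    by (simp add: s_def flip: mult.assoc power_mult_distrib)
  have neg: "s * (\<Prod>j=1..m. x - 2 * int j) = (\<Prod>j=1..m. 2 * int j - x)" for x
    using prod_uminus[of "\<lambda>j. x - 2 * int j" "{1..m}"] by (simp add: s_def)

  have "D * (s * C) = (\<Prod>j=1..m. 2 * int j - 2 * p)"
    unfolding neg[symmetric] using prod_evens_times_central_binomial[of m]
    by (simp only: D_def C_def p mult.left_commute[of _ s])
  with F[of "2 * p"] have A: "[s * C = F (2 * p)] (mod p ^ 3)"
    using cong_mult_lcancel[OF copD] by metis
  have "D * (s * C) = 4 ^ m * (\<Prod>j=1..m. 2 * int j - p)"
    unfolding neg[symmetric] using prod_evens_times_central_binomial'[of m]
    by (simp only: D_def C_def p mult.left_commute[of _ s])
  also have "[\<dots> = 4 ^ m * (D * F p)] (mod p ^ 3)"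
    by (intro cong_mult cong_refl F)
  also have "4 ^ m * (D * F p) = D * (4 ^ m * F p)"
    by simp
  finally have B: "[s * C = 4 ^ m * F p] (mod p ^ 3)"
    using cong_mult_lcancel[OF copD] by metis

  have "[q = 0] (mod p)"
    unfolding q_def b_def
  proof (rule sum_even_odd_inverse_squares_cong_0(1)[OF assms])
    show "[x * c x = 1] (mod p)" if "x \<in> {1..<p}" for x
      using inv[OF that] by (rule cong_dvd_modulus) simp
  qed
  \<comment> \<open>In the second-order expansion the power sum of squares comes with the square of
    p, so it drops out and only \<open>e\<close> remains.\<close>
  then have q: "p ^ 3 dvd p\<^sup>2 * q"
    by (simp add: cong_0_iff power2_eq_square power3_eq_cube)
  have two_F: "p ^ 3 dvd 2 * F (a * p) - (2 - 2 * a * p * e + a\<^sup>2 * p\<^sup>2 * e\<^sup>2)" for a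
  proof -
    have "[2 * F (a * p) = 2 - 2 * (a * p) * e + (a * p)\<^sup>2 * (e\<^sup>2 - q)] (mod (a * p) ^ 3)"
      unfolding F_def e_def q_def by (rule prod_one_minus_cong_cube) simp
    then have "p ^ 3 dvd 2 * F (a * p) - (2 - 2 * (a * p) * e + (a * p)\<^sup>2 * (e\<^sup>2 - q))"
      unfolding cong_iff_dvd_diff power_mult_distrib[of a p 3] by (rule dvd_mult_right)
    moreover have "p ^ 3 dvd a\<^sup>2 * (p\<^sup>2 * q)"
      using q by (rule dvd_mult)
    ultimately have "p ^ 3 dvd 2 * F (a * p) - (2 - 2 * (a * p) * e + (a * p)\<^sup>2 * (e\<^sup>2 - q)) - a\<^sup>2 * (p\<^sup>2 * q)"
      by (rule dvd_diff)
    also have "\<dots> = 2 * F (a * p) - (2 - 2 * a * p * e + a\<^sup>2 * p\<^sup>2 * e\<^sup>2)"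
      by (simp add: power_mult_distrib algebra_simps)
    finally show ?thesis .
  qed
  define W where "W = 2 - 2 * p * e + p\<^sup>2 * e\<^sup>2"
  have "p ^ 3 dvd (2 * F p - W) * (2 * F p + W)"
    using two_F[of 1] by (simp add: W_def)
  moreover have "p ^ 3 dvd 2 * (2 * F (2 * p) - (2 - 4 * p * e + 4 * p\<^sup>2 * e\<^sup>2))"
    using two_F[of 2] by (intro dvd_mult) simp
  \<comment> \<open>This is exactly the amount by which twice the expansion of
    \<open>2 * F (2 * p)\<close> exceeds the square of \<open>W\<close>.\<close>
  moreover have "p ^ 3 dvd p ^ 3 * (4 * e ^ 3 - p * e ^ 4)"
    by simp
  ultimately have "p ^ 3 dvd 2 * (2 * F (2 * p) - (2 - 4 * p * e + 4 * p\<^sup>2 * e\<^sup>2))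
      - (2 * F p - W) * (2 * F p + W) + p ^ 3 * (4 * e ^ 3 - p * e ^ 4)"
    by (intro dvd_add dvd_diff)
  also have "\<dots> = 4 * F (2 * p) - 4 * (F p * F p)"
    unfolding W_def by (simp add: algebra_simps power2_eq_square power3_eq_cube power4_eq_xxxx)
  finally have "[4 * F (2 * p) = 4 * (F p * F p)] (mod p ^ 3)"
    by (simp only: cong_iff_dvd_diff)
  then have "[F (2 * p) = F p * F p] (mod p ^ 3)"
    by (simp only: cong_mult_lcancel[OF cop4])
  with A B have "[4 ^ m * F p = F p * F p] (mod p ^ 3)"
    by (meson cong_sym cong_trans)
  then have "[4 ^ m = F p] (mod p ^ 3)"
    using cong_mult_rcancel[OF copB] by metis
  then have "[4 ^ m * F p = 4 ^ m * 4 ^ m] (mod p ^ 3)"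
    by (intro cong_mult cong_refl) (rule cong_sym)
  with B have "[s * C = 4 ^ m * 4 ^ m] (mod p ^ 3)"
    by (rule cong_trans)
  then have "[s * (s * C) = s * (4 ^ m * 4 ^ m)] (mod p ^ 3)"
    by (rule cong_scalar_left)
  then show ?thesis
    unfolding s by (simp add: C_def s_def mult_2 power_add)
qed

section \<open>Products of central binomial coefficients away from the middle\<close>

text \<open>Clearing the denominator n! leaves (p + 1)...(p + n), which is n! again modulo p. This
  feeds the case k = 0 below, with n = 2m.\<close>

lemma binomial_cong_1:
  fixes p :: int
  assumes "prime p" and p: "p = int n + 1"
  shows "[int (2 * n + 1 choose n) = 1] (mod p)"
proof -
  let ?P = "\<Prod>j=1..n. int j"
  have "coprime ?P p"
    by (intro prod_coprime_left coprime_prime_of_less assms) (auto simp: p)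
  moreover have "[?P * int (2 * n + 1 choose n) = ?P * 1] (mod p)"
  proof -
    have "?P * int (2 * n + 1 choose n) = (\<Prod>j=1..n. p + int j)"
      using prod_times_binomial[of n "n + 1"] by (simp add: p mult_2 add_ac del: binomial_Suc_Suc)
    also have "[\<dots> = ?P] (mod p)"
      by (intro cong_prod) (simp add: cong_iff_dvd_diff)
    finally show ?thesis
      by simp
  qed
  ultimately show ?thesis
    using cong_mult_lcancel by blast
qed

text \<open>Consecutive products have ratio (2K - 1)/(2K + 1) modulo p, where K = k + 1. They are
  divisible by p, so knowing the ratio modulo p determines them modulo the square of p. The bound on
  k keeps 2k + 1 below p, hence invertible.\<close>

lemma central_binomial_product_cong:
  fixes p :: int
  assumes "prime p" and p: "p = 2 * int m + 1" and "k < m"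
  shows "[(2 * int k + 1) * (int (2 * k choose k) * int (2 * (2 * m - k) choose (2 * m - k))) = - p] (mod p\<^sup>2)"
  using assms(3)
proof (induction k)
  case 0
  define T where "T = int (2 * (2 * m) choose (2 * m))"
  define X where "X = int (2 * (2 * m) + 1 choose (2 * m))"
  \<comment> \<open>Absorption exposes the factor p = 2m + 1, while 4m + 1 = 2p - 1.\<close>
  have "Suc (2 * (2 * m)) * (2 * (2 * m) choose (2 * m))
      = (Suc (2 * (2 * m)) choose Suc (2 * m)) * Suc (2 * m)"
    by (rule Suc_times_binomial_eq)
  also have "(Suc (2 * (2 * m)) choose Suc (2 * m)) = (2 * (2 * m) + 1 choose (2 * m))"
    using binomial_symmetric[of "2 * m" "2 * (2 * m) + 1"] by simp
  finally have "int (Suc (2 * (2 * m))) * T = X * int (Suc (2 * m))"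
    unfolding T_def X_def by (metis of_nat_mult)
  then have TX: "(2 * p - 1) * T = X * p"
    by (simp add: p algebra_simps)
  have "[X = 1] (mod p)"
    unfolding X_def by (rule binomial_cong_1) (use assms(1) p in auto)
  then obtain y where y: "X = 1 + p * y"
    by (metis cong_iff_lin cong_sym mult.commute)
  \<comment> \<open>Multiplying by 2p + 1 inverts 2p - 1 up to sign, since their product is 4 times
    the square of p, minus 1.\<close>
  have "T + p = p\<^sup>2 * (4 * T) - (2 * p + 1) * ((2 * p - 1) * T) + p"
    by (simp add: algebra_simps power2_eq_square)
  also have "\<dots> = p\<^sup>2 * (4 * T - 2 - 2 * p * y - y)"
    unfolding TX y by (simp add: algebra_simps power2_eq_square)
  finally show ?case
    by (simp add: cong_iff_dvd_diff T_def)
next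
  case (Suc k)
  define K where "K = int (Suc k)"
  define n where "n = 2 * m - Suc k"
  define T where "T = int (2 * k choose k) * int (2 * Suc n choose Suc n)"
  define T' where "T' = int (2 * Suc k choose Suc k) * int (2 * n choose n)"
  have n: "2 * m - k = Suc n" "int n = p - 1 - K"
    using Suc.prems by (auto simp: n_def K_def p)
  have IH: "[(2 * K - 1) * T = - p] (mod p\<^sup>2)"
  proof -
    have "[(2 * int k + 1) * T = - p] (mod p\<^sup>2)"
      using Suc.IH Suc.prems unfolding n(1) T_def by (simp only: Suc_lessD)
    moreover have "2 * int k + 1 = 2 * K - 1"
      by (simp add: K_def)
    ultimately show ?thesis
      by (simp only:)
  qed
  have "int (Suc k * (2 * Suc k choose Suc k)) = int (2 * (2 * k + 1) * (2 * k choose k))"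
    "int (Suc n * (2 * Suc n choose Suc n)) = int (2 * (2 * n + 1) * (2 * n choose n))"
    unfolding Suc_times_central_binomial by simp_all
  then have rec: "K * int (2 * Suc k choose Suc k) = 2 * (2 * K - 1) * int (2 * k choose k)"
    "(p - K) * int (2 * Suc n choose Suc n) = 2 * (2 * p - (2 * K + 1)) * int (2 * n choose n)"
    using n(2) by (simp_all add: K_def algebra_simps del: binomial_Suc_Suc)
  have "2 * (K * (T' * (2 * p - (2 * K + 1)))) =
      (K * int (2 * Suc k choose Suc k)) * (2 * (2 * p - (2 * K + 1)) * int (2 * n choose n))"
    by (simp only: T'_def mult_ac)
  also have "\<dots> = 2 * ((p - K) * ((2 * K - 1) * T))"
    unfolding rec(1) rec(2)[symmetric] by (simp only: T_def mult_ac)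
  finally have "K * (T' * (2 * p - (2 * K + 1))) = (p - K) * ((2 * K - 1) * T)"
    by simp
  also have "[\<dots> = (p - K) * (- p)] (mod p\<^sup>2)"
    by (intro cong_mult cong_refl IH)
  also have "[(p - K) * (- p) = K * p] (mod p\<^sup>2)"
    by (simp add: cong_iff_dvd_diff algebra_simps power2_eq_square)
  finally have "[K * (T' * (2 * p - (2 * K + 1))) = K * p] (mod p\<^sup>2)" .
  moreover have "coprime K (p\<^sup>2)"
    using coprime_prime_of_less[OF assms(1), of K] Suc.prems by (simp add: K_def p)
  ultimately have *: "[T' * (2 * p - (2 * K + 1)) = p] (mod p\<^sup>2)"
    using cong_mult_lcancel by blast
  \<comment> \<open>First only the divisibility of \<open>T'\<close> by p is extracted; it then
    removes the term \<open>T' * (2 * p)\<close> modulo the square of p.\<close>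
  then have "[T' * (2 * p - (2 * K + 1)) = p] (mod p)"
    by (rule cong_dvd_modulus) simp
  then have "[T' * (2 * p - (2 * K + 1)) = 0] (mod p)"
    by (simp add: cong_def)
  then have "p dvd T' * (2 * p) - T' * (2 * p - (2 * K + 1))"
    by (intro dvd_diff) (simp_all add: cong_0_iff)
  then have "p dvd T' * (2 * K + 1)"
    by (simp add: algebra_simps)
  moreover have "coprime (2 * K + 1) p"
    using coprime_prime_of_less[OF assms(1), of "2 * K + 1"] Suc.prems by (simp add: K_def p)
  ultimately have "p dvd T'"
    by (simp add: coprime_commute coprime_dvd_mult_left_iff)
  then have "p\<^sup>2 dvd T' * (2 * p)"
    by (auto simp: power2_eq_square)
  moreover have "p\<^sup>2 dvd T' * (2 * p - (2 * K + 1)) - p"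
    using * by (simp add: cong_iff_dvd_diff)
  ultimately have "p\<^sup>2 dvd T' * (2 * p) - (T' * (2 * p - (2 * K + 1)) - p)"
    by (rule dvd_diff)
  also have "\<dots> = (2 * K + 1) * T' - (- p)"
    by (simp add: algebra_simps)
  finally show ?case
    by (simp only: cong_iff_dvd_diff T'_def K_def n_def)
qed

section \<open>Evaluation of the sum\<close>

lemma sum_symmetric_split:
  fixes f :: "nat \<Rightarrow> int"
  assumes "\<And>k. k \<le> 2 * m \<Longrightarrow> f (2 * m - k) = f k"
  shows "(\<Sum>k=0..2 * m. f k) = 2 * (\<Sum>k<m. f k) + f m"
proof -
  have "(\<Sum>k=0..2 * m. f k) = (\<Sum>k<m. f k) + f m + (\<Sum>k=Suc m..2 * m. f k)"
  proof -
    have "{0..2 * m} = {..<m} \<union> {m} \<union> {Suc m..2 * m}"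
      by auto
    then show ?thesis
      by (simp only:) (subst sum.union_disjoint; auto simp: add.commute)
  qed
  also have "(\<Sum>k=Suc m..2 * m. f k) = (\<Sum>k<m. f k)"
    by (rule sum.reindex_bij_witness[of _ "\<lambda>k. 2 * m - k" "\<lambda>k. 2 * m - k"]) (auto simp: assms)
  finally show ?thesis
    by simp
qed

theorem theorem3p3:
  fixes p :: nat
  assumes "prime p" and "p > 3"
  shows "[V (p - 1) = 256 ^ (p - 1)] (mod p ^ 3)"
proof -
  obtain m where m: "p = 2 * m + 1"
    using prime_odd_nat[OF assms(1)] assms(2) by (auto elim: oddE)
  define P where "P = int p"
  have P: "prime P" "P > 3" "P = 2 * int m + 1"
    using assms by (simp add: P_def, simp add: P_def, simp add: P_def m)
  define c where "c = modular_inverse (P ^ 3)"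
  have inv: "[x * c x = 1] (mod P ^ 3)" if "x \<in> {1..<P}" for x
    unfolding c_def by (rule cong_modular_inverse1) (use coprime_prime_of_less[OF P(1) that] in simp)
  define T where "T k = int (2 * k choose k) * int (2 * (2 * m - k) choose (2 * m - k))" for k
  have "int (V (p - 1)) = (\<Sum>k=0..2 * m. (T k)\<^sup>2)"
    by (simp add: V_def m T_def power_mult_distrib diff_mult_distrib2)
  also have "\<dots> = 2 * (\<Sum>k<m. (T k)\<^sup>2) + (T m)\<^sup>2"
    by (rule sum_symmetric_split) (simp add: T_def mult.commute)
  also have "[\<dots> = 2 * 0 + ((-1) ^ m * 4 ^ (2 * m)) ^ 4] (mod P ^ 3)"
  proof (intro cong_add cong_mult cong_refl)
    have "(T m)\<^sup>2 = int (2 * m choose m) ^ 4"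
      by (simp add: T_def power2_eq_square power4_eq_xxxx)
    then show "[(T m)\<^sup>2 = ((-1) ^ m * 4 ^ (2 * m)) ^ 4] (mod P ^ 3)"
      using cong_pow[OF Morley_congruence[OF P]] by simp
    have "[(T k)\<^sup>2 = P\<^sup>2 * (c (2 * int k + 1))\<^sup>2] (mod P ^ 3)" if "k \<in> {..<m}" for k
    proof -
      let ?x = "2 * int k + 1"
      have "[?x * T k = - P] (mod P\<^sup>2)"
        unfolding T_def by (rule central_binomial_product_cong) (use P that in auto)
      then obtain u where u: "?x * T k = - P + P\<^sup>2 * u"
        by (metis cong_iff_lin cong_sym mult.commute)
      \<comment> \<open>Squaring gains a power of p: the cross term of -P with an error divisible by
        the square of P is already divisible by the cube.\<close>
      have "(?x * T k)\<^sup>2 = P\<^sup>2 + P ^ 3 * (P * u\<^sup>2 - 2 * u)"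
        unfolding u by (simp add: algebra_simps power2_eq_square power3_eq_cube)
      then have "[(?x * T k)\<^sup>2 = P\<^sup>2] (mod P ^ 3)"
        by (simp add: cong_iff_dvd_diff)
      then have *: "[(?x * T k)\<^sup>2 * (c ?x)\<^sup>2 = P\<^sup>2 * (c ?x)\<^sup>2] (mod P ^ 3)"
        by (rule cong_scalar_right)
      have "[(T k)\<^sup>2 * (?x * c ?x)\<^sup>2 = (T k)\<^sup>2 * 1\<^sup>2] (mod P ^ 3)"
        using that by (intro cong_mult cong_pow cong_refl inv) (auto simp: P)
      then have "[(T k)\<^sup>2 = (T k)\<^sup>2 * (?x * c ?x)\<^sup>2] (mod P ^ 3)"
        by (simp only: power_one mult_1_right cong_sym_eq)
      also have "(T k)\<^sup>2 * (?x * c ?x)\<^sup>2 = (?x * T k)\<^sup>2 * (c ?x)\<^sup>2"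
        by (simp only: power_mult_distrib ac_simps)
      finally show ?thesis
        using * by (rule cong_trans)
    qed
    then have "[(\<Sum>k<m. (T k)\<^sup>2) = (\<Sum>k<m. P\<^sup>2 * (c (2 * int k + 1))\<^sup>2)] (mod P ^ 3)"
      by (rule cong_sum)
    also have "(\<Sum>k<m. P\<^sup>2 * (c (2 * int k + 1))\<^sup>2) = P\<^sup>2 * (\<Sum>j=1..m. (c (2 * int j - 1))\<^sup>2)"
      by (simp add: sum.atLeast1_atMost_eq sum_distrib_left algebra_simps)
    also have "[\<dots> = 0] (mod P ^ 3)"
    proof -
      have "[(\<Sum>j=1..m. (c (2 * int j - 1))\<^sup>2) = 0] (mod P)"
      proof (rule sum_even_odd_inverse_squares_cong_0(2)[OF P])
        show "[x * c x = 1] (mod P)" if "x \<in> {1..<P}" for x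
          using inv[OF that] by (rule cong_dvd_modulus) simp
      qed
      then show ?thesis
        by (simp add: cong_0_iff power2_eq_square power3_eq_cube)
    qed
    finally show "[(\<Sum>k<m. (T k)\<^sup>2) = 0] (mod P ^ 3)" .
  qed
  \<comment> \<open>The fourth power removes Morley's sign and turns 4 into 256.\<close>
  also have "2 * 0 + ((-1) ^ m * 4 ^ (2 * m)) ^ 4 = int (256 ^ (p - 1))"
  proof -
    have "((-1) ^ m :: int) ^ 4 = ((-1) ^ 4) ^ m" "(4 ^ (2 * m) :: int) ^ 4 = (4 ^ 4) ^ (2 * m)"
      by (simp_all only: power_mult[symmetric] mult.commute)
    then show ?thesis
      by (simp add: power_mult_distrib m)
  qed
  finally have "[int (V (p - 1)) = int (256 ^ (p - 1))] (mod int (p ^ 3))"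
    by (simp add: P_def)
  then show ?thesis
    by (simp only: cong_int_iff)
qed

end
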